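(* Let $(M,S,\eta)$ be a factorable monoid, write $f'=\eta'(f)$ and $\overline{f}=\overline{\eta}(f)$ for $f\in M$, let $F=\eta\circ\mu:M^2\to M^2$, and let $\varphi$ be the restriction of $F$ to $S^2$. Then the following properties are equivalent. (1) For all $s\in S_+$ and $f\in M$, the equalities $(sf)'=(sf')'$ and $\overline{sf}=\overline{sf'}\cdot\overline{f}$ hold. (2) For all $(f,g,h)\in M^3$, $F_1F_2F_1F_2(f,g,h)=F_2F_1F_2(f,g,h)$. (3) For each $(r,s,t)\in S_+^3$ such that $\varphi_2\varphi_1\varphi_2(r,s,t)$ contains $1$, $F_1F_2F_1F_2(r,s,t)=F_2F_1F_2(r,s,t)$. (4) The quadratic normalisation $(S,N'_\varphi)$ mod $1$ for $M$ is of class $(4,3)$.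
   Context: Notation. $M$ is a monoid with multiplication $\mu:M^2\to M$, $S\subseteq M$ is a generating subset with $1\in S$, and $S_+=S\setminus\{1\}$. $S^*$ is the free monoid over $S$; its elements are words $(s_1,\ldots,s_n)=s_1|\cdots|s_n$; $|w|$ is the length of a word. For $f\in M$, $|f|$ is the minimal length of an $S$-word representing $f$ (so $|1|=0$). For a set $A$ and $F:A^2\to A^2$, $F_i$ applies $F$ to the entries at positions $i,i+1$ of a word over $A$ (counted from the left). Compositions are read with the rightmost map applied first. Factorability. A factorisation map for $(M,S)$ is a map $\eta=(\eta',\overline{\eta}):M\to M^2$ with $\eta(1)=(1,1)$ and, for every $f\ne1$: $\eta'(f)\in S_+$, $\eta'(f)\cdot\overline{\eta}(f)=f$, $|f|=|\eta'(f)|+|\overline{\eta}(f)|$. It is a factorability structure, and $(M,S,\eta)$ is a factorable monoid, if, with $F=\eta\circ\mu$, for every triple in $M^3$ either $F_1F_2F_1F_2$, $F_2F_1F_2$, $F_2F_1F_2F_1$ take the same value on it or each of these three maps strictly reduces the sum of the lengths of the entries. The restriction $\varphi$ of $\eta\mu$ to $S^2$ takes values in $S^2$. The maps $N_\varphi$ and $N'_\varphi$. For $w\in S^*$ put $T_\varphi(w)=\varphi_{|w|-1}\cdots\varphi_1(w)$ ($T_\varphi(w)=w$ if $|w|=1$). $N_\varphi:S^*\to S^*$ is defined recursively: $N_\varphi$ of the empty word is empty; $N_\varphi$ of a word containing the letter $1$ equals $N_\varphi$ of the word with $1$ removed; for $s_1,\ldots,s_n\in S_+$, putting $v=T_\varphi(s_1|N_\varphi(s_2,\ldots,s_n))$,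 $N_\varphi(s_1,\ldots,s_n)=v$ if $v$ contains no $1$, and $=N_\varphi(v)$ otherwise. Then $N'_\varphi(w)=N_\varphi(w)|1^m$ with $m=|w|-|N_\varphi(w)|$. Normalisation. A normalisation is a pair $(A,N)$ with $N:A^*\to A^*$ length-preserving, identity on one-letter words, and $N(u|v|w)=N(u|N(v)|w)$ for all words $u,v,w$; $w$ is $N$-normal if $N(w)=w$; $\overline{N}$ is the restriction of $N$ to length-two words. $(A,N)$ is quadratic if a word is $N$-normal iff all its length-two factors are, and for each word $w$ there is a finite sequence of positions $(i_1,\ldots,i_k)$ with $N(w)=\overline{N}_{i_k}\cdots\overline{N}_{i_1}(w)$. $e\in A$ is $N$-neutral if $N(w|e)=N(e|w)=N(w)|e$ for all $w$. $(S,N)$ is a normalisation mod $1$ for $M$ if $1\in S$ is $N$-neutral and $M$ is presented (via the inclusion $S\subseteq M$) by $\langle S\mid\{w=N(w):w\in S^*\}\cup\{1_S=1\}\rangle$, where $1_S$ is the letter $1$ of $S$. For a factorable monoid, $(S,N'_\varphi)$ is a quadratic normalisation mod $1$ for $M$. Class. A quadratic normalisation $(A,N)$ is of left-class $m$ (resp. right-class $n$) if for every length-three word $w$, $N(w)$ is obtained from $w$ by applying alternately $\overline{N}_1,\overline{N}_2,\overline{N}_1,\ldots$ ($m$ maps in total, $\overline{N}_1$ first) (resp. $\overline{N}_2,\overline{N}_1,\overline{N}_2,\ldots$, $n$ maps in total, $\overline{N}_2$ first). It is of class $(m,n)$ if it is of left-class $m$ and right-class $n$. *)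

theory Defs
  imports Main
begin

section \<open>Factorable monoids\<close>

text \<open>
  The monoid \<open>M\<close> is the whole type \<open>'a :: monoid_mult\<close>. Words over a set \<open>A\<close> are
  the elements of \<open>lists A\<close>; the word \<open>w\<close> over a subset of \<open>M\<close> represents
  \<open>prod_list w\<close>.
\<close>

definition generates :: "'a::monoid_mult set \<Rightarrow> bool" where
  "generates S \<longleftrightarrow> (\<forall>f. \<exists>w\<in>lists S. prod_list w = f)"

definition wlen :: "'a::monoid_mult set \<Rightarrow> 'a \<Rightarrow> nat" where
  "wlen S f = (LEAST n. \<exists>w\<in>lists S. prod_list w = f \<and> length w = n)"

text \<open>
  \<open>at_pos F i w\<close> is \<open>F\<^sub>i w\<close>. Positions are counted from 1, so the entries at
  positions \<open>i\<close> and \<open>i + 1\<close> are \<open>w ! (i - 1)\<close> and \<open>w ! i\<close>; the definition is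
  meaningful for \<open>1 \<le> i < length w\<close> only.
\<close>

definition at_pos :: "('a \<times> 'a \<Rightarrow> 'a \<times> 'a) \<Rightarrow> nat \<Rightarrow> 'a list \<Rightarrow> 'a list" where
  "at_pos F i w = (let p = F (w ! (i - 1), w ! i) in w[i - 1 := fst p, i := snd p])"

lemma length_at_pos [simp]: "length (at_pos F i w) = length w"
  by (simp add: at_pos_def Let_def)

definition factorisation_map :: "'a::monoid_mult set \<Rightarrow> ('a \<Rightarrow> 'a \<times> 'a) \<Rightarrow> bool" where
  "factorisation_map S \<eta> \<longleftrightarrow>
     \<eta> 1 = (1, 1) \<and>
     (\<forall>f. f \<noteq> 1 \<longrightarrow>
        fst (\<eta> f) \<in> S - {1} \<and>
        fst (\<eta> f) * snd (\<eta> f) = f \<and>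
        wlen S f = wlen S (fst (\<eta> f)) + wlen S (snd (\<eta> f)))"

definition eta_mu :: "('a::monoid_mult \<Rightarrow> 'a \<times> 'a) \<Rightarrow> 'a \<times> 'a \<Rightarrow> 'a \<times> 'a" where
  "eta_mu \<eta> = (\<lambda>(f, g). \<eta> (f * g))"

definition phi :: "'a::monoid_mult set \<Rightarrow> ('a \<Rightarrow> 'a \<times> 'a) \<Rightarrow> 'a \<times> 'a \<Rightarrow> 'a \<times> 'a" where
  "phi S \<eta> = (\<lambda>p. if p \<in> S \<times> S then eta_mu \<eta> p else undefined)"

definition total_wlen :: "'a::monoid_mult set \<Rightarrow> 'a list \<Rightarrow> nat" where
  "total_wlen S w = sum_list (map (wlen S) w)"

definition factorability_structure :: "'a::monoid_mult set \<Rightarrow> ('a \<Rightarrow> 'a \<times> 'a) \<Rightarrow> bool" where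
  "factorability_structure S \<eta> \<longleftrightarrow>
     factorisation_map S \<eta> \<and>
     (\<forall>f g h.
        let F1 = at_pos (eta_mu \<eta>) 1; F2 = at_pos (eta_mu \<eta>) 2;
            w = [f, g, h];
            a = (F1 \<circ> F2 \<circ> F1 \<circ> F2) w;
            b = (F2 \<circ> F1 \<circ> F2) w;
            c = (F2 \<circ> F1 \<circ> F2 \<circ> F1) w
        in (a = b \<and> b = c) \<or>
           (total_wlen S a < total_wlen S w \<and>
            total_wlen S b < total_wlen S w \<and>
            total_wlen S c < total_wlen S w))"

definition factorable_monoid :: "'a::monoid_mult set \<Rightarrow> ('a \<Rightarrow> 'a \<times> 'a) \<Rightarrow> bool" where
  "factorable_monoid S \<eta> \<longleftrightarrow> generates S \<and> 1 \<in> S \<and> factorability_structure S \<eta>"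


section \<open>The maps \<open>N\<^sub>\<phi>\<close> and \<open>N'\<^sub>\<phi>\<close>\<close>

text \<open>\<open>fold\<close> applies the map at position 1 first and the one at position \<open>length w - 1\<close> last.\<close>

definition T_phi :: "('a \<times> 'a \<Rightarrow> 'a \<times> 'a) \<Rightarrow> 'a list \<Rightarrow> 'a list" where
  "T_phi \<phi> w = fold (at_pos \<phi>) [1..<length w] w"

lemma length_T_phi [simp]: "length (T_phi \<phi> w) = length w"
proof -
  have "length (fold (at_pos \<phi>) is w) = length w" for "is"
    by (induction "is" arbitrary: w) auto
  then show ?thesis by (simp add: T_phi_def)
qed

function N_phi :: "('a::monoid_mult \<times> 'a \<Rightarrow> 'a \<times> 'a) \<Rightarrow> 'a list \<Rightarrow> 'a list" where
  "N_phi \<phi> [] = []"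
| "N_phi \<phi> (s # w) =
     (if 1 \<in> set (s # w) then N_phi \<phi> (removeAll 1 (s # w))
      else let v = T_phi \<phi> (s # N_phi \<phi> w)
           in if 1 \<in> set v then N_phi \<phi> v else v)"
  by pat_completeness auto

lemma length_removeAll_le: "length (removeAll x xs) \<le> length xs"
  by (simp add: removeAll_filter_not_eq)

lemma length_N_phi_dom: "N_phi_dom (\<phi>, w) \<Longrightarrow> length (N_phi \<phi> w) \<le> length w"
proof (induction \<phi> w rule: N_phi.pinduct)
  case (1 \<phi>)
  then show ?case by (simp add: N_phi.psimps(1))
next
  case (2 \<phi> s w)
  note eq = N_phi.psimps(2)[OF 2(1)]
  show ?case
  proof (cases "1 \<in> set (s # w)")
    case True
    have "length (N_phi \<phi> (s # w)) = length (N_phi \<phi> (removeAll 1 (s # w)))"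
      by (subst eq) (simp only: True if_True)
    also have "\<dots> \<le> length (removeAll 1 (s # w))"
      using 2(2)[OF True] .
    also have "\<dots> \<le> length (s # w)"
      by (rule length_removeAll_le)
    finally show ?thesis .
  next
    case False
    define v where "v = T_phi \<phi> (s # N_phi \<phi> w)"
    have v: "length v \<le> length (s # w)"
      using 2(3)[OF False] by (simp add: v_def)
    have "N_phi \<phi> (s # w) = (if 1 \<in> set v then N_phi \<phi> v else v)"
      by (subst eq) (simp only: False if_False Let_def v_def)
    moreover have "length (N_phi \<phi> v) \<le> length v" if "1 \<in> set v"
      using 2(4)[OF False v_def that] .
    ultimately show ?thesis using v by (cases "1 \<in> set v") simp_all
  qed
qed

text \<open>
  The recursion ends because the number of letters other than 1 decreases, except in
  the step that removes the letters 1.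
\<close>

termination N_phi
proof (relation "measure (\<lambda>(\<phi>, w). 2 * length (removeAll 1 w) + (if 1 \<in> set w then 1 else 0))",
    goal_cases)
  case 1
  show ?case by simp
next
  case (2 \<phi> s w)
  then show ?case by auto
next
  case (3 \<phi> s w)
  then show ?case by simp
next
  case (4 \<phi> s w v)
  have "length v \<le> Suc (length w)"
    using length_N_phi_dom[OF 4(4)] 4(2) by simp
  moreover have "length (removeAll 1 v) < length v"
    using 4(3) by (rule length_removeAll_less)
  moreover have "removeAll 1 (s # w) = s # w"
    using 4(1) by (rule removeAll_id)
  ultimately show ?case using 4(1,3) by simp
qed

definition N'_phi :: "('a::monoid_mult \<times> 'a \<Rightarrow> 'a \<times> 'a) \<Rightarrow> 'a list \<Rightarrow> 'a list" where
  "N'_phi \<phi> w = N_phi \<phi> w @ replicate (length w - length (N_phi \<phi> w)) 1"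


section \<open>Normalisations\<close>

definition normalisation :: "'a set \<Rightarrow> ('a list \<Rightarrow> 'a list) \<Rightarrow> bool" where
  "normalisation A N \<longleftrightarrow>
     (\<forall>w\<in>lists A. N w \<in> lists A \<and> length (N w) = length w) \<and>
     (\<forall>a\<in>A. N [a] = [a]) \<and>
     (\<forall>u\<in>lists A. \<forall>v\<in>lists A. \<forall>w\<in>lists A. N (u @ v @ w) = N (u @ N v @ w))"

text \<open>The restriction of \<open>N\<close> to words of length two, as a map on pairs.\<close>

definition N_bar :: "('a list \<Rightarrow> 'a list) \<Rightarrow> 'a \<times> 'a \<Rightarrow> 'a \<times> 'a" where
  "N_bar N = (\<lambda>(a, b). (N [a, b] ! 0, N [a, b] ! 1))"

definition quadratic :: "'a set \<Rightarrow> ('a list \<Rightarrow> 'a list) \<Rightarrow> bool" where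
  "quadratic A N \<longleftrightarrow>
     normalisation A N \<and>
     (\<forall>w\<in>lists A. N w = w \<longleftrightarrow> (\<forall>u a b v. w = u @ [a, b] @ v \<longrightarrow> N [a, b] = [a, b])) \<and>
     (\<forall>w\<in>lists A. \<exists>is. set is \<subseteq> {1..<length w} \<and> N w = fold (at_pos (N_bar N)) is w)"

definition neutral :: "'a set \<Rightarrow> ('a list \<Rightarrow> 'a list) \<Rightarrow> 'a \<Rightarrow> bool" where
  "neutral A N e \<longleftrightarrow> e \<in> A \<and> (\<forall>w\<in>lists A. N (w @ [e]) = N w @ [e] \<and> N ([e] @ w) = N w @ [e])"

text \<open>The congruence on the free monoid over \<open>S\<close> generated by a set \<open>R\<close> of relations.\<close>

inductive word_cong :: "'a set \<Rightarrow> ('a list \<times> 'a list) set \<Rightarrow> 'a list \<Rightarrow> 'a list \<Rightarrow> bool"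
  for S R where
  rel: "(u, v) \<in> R \<Longrightarrow> x \<in> lists S \<Longrightarrow> y \<in> lists S \<Longrightarrow> word_cong S R (x @ u @ y) (x @ v @ y)"
| refl: "w \<in> lists S \<Longrightarrow> word_cong S R w w"
| sym: "word_cong S R u v \<Longrightarrow> word_cong S R v u"
| trans: "word_cong S R u v \<Longrightarrow> word_cong S R v w \<Longrightarrow> word_cong S R u w"

text \<open>
  \<open>M\<close> is presented by \<open>\<langle>S | R\<rangle>\<close> via the inclusion of \<open>S\<close>: the canonical map from the
  free monoid over \<open>S\<close> to \<open>M\<close> is onto, and its kernel is the congruence generated by \<open>R\<close>.
\<close>

definition presented_by :: "'a::monoid_mult set \<Rightarrow> ('a list \<times> 'a list) set \<Rightarrow> bool" where
  "presented_by S R \<longleftrightarrow>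
     generates S \<and>
     (\<forall>u\<in>lists S. \<forall>v\<in>lists S. prod_list u = prod_list v \<longleftrightarrow> word_cong S R u v)"

definition normalisation_mod_1 :: "'a::monoid_mult set \<Rightarrow> ('a list \<Rightarrow> 'a list) \<Rightarrow> bool" where
  "normalisation_mod_1 S N \<longleftrightarrow>
     normalisation S N \<and> neutral S N 1 \<and>
     presented_by S ({(w, N w) | w. w \<in> lists S} \<union> {([1], [])})"

text \<open>\<open>alternate F i j m\<close> applies \<open>m\<close> maps, alternately \<open>F\<^sub>i, F\<^sub>j, F\<^sub>i, \<dots>\<close>, with \<open>F\<^sub>i\<close> first.\<close>

primrec alternate ::
  "('a \<times> 'a \<Rightarrow> 'a \<times> 'a) \<Rightarrow> nat \<Rightarrow> nat \<Rightarrow> nat \<Rightarrow> 'a list \<Rightarrow> 'a list" where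
  "alternate F i j 0 w = w"
| "alternate F i j (Suc m) w = alternate F j i m (at_pos F i w)"

definition left_class :: "'a set \<Rightarrow> ('a list \<Rightarrow> 'a list) \<Rightarrow> nat \<Rightarrow> bool" where
  "left_class A N m \<longleftrightarrow>
     quadratic A N \<and>
     (\<forall>w\<in>lists A. length w = 3 \<longrightarrow> N w = alternate (N_bar N) 1 2 m w)"

definition right_class :: "'a set \<Rightarrow> ('a list \<Rightarrow> 'a list) \<Rightarrow> nat \<Rightarrow> bool" where
  "right_class A N n \<longleftrightarrow>
     quadratic A N \<and>
     (\<forall>w\<in>lists A. length w = 3 \<longrightarrow> N w = alternate (N_bar N) 2 1 n w)"

definition of_class :: "'a set \<Rightarrow> ('a list \<Rightarrow> 'a list) \<Rightarrow> nat \<Rightarrow> nat \<Rightarrow> bool" where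
  "of_class A N m n \<longleftrightarrow> left_class A N m \<and> right_class A N n"

end

theory Submission imports Defs begin

text \<open>
  The recognition principle says that \<open>(f, g)\<close> is fixed by \<open>F = \<eta>\<mu>\<close> iff \<open>(f, g')\<close> is; it comes
  out of the factorability condition at \<open>(1, f, g)\<close> and \<open>(f, g, 1)\<close>. It shows that both the
  equalities in (1) at \<open>(f, gh)\<close> and the equation in (2) at \<open>(f, g, h)\<close> say that one and the
  same pair is fixed by \<open>F\<close>. Inductions on length then reduce (1) to generators, and on
  generators (2) can fail only where lengths drop, that is, where \<open>\<phi>\<^sub>2\<phi>\<^sub>1\<phi>\<^sub>2\<close> creates a letter 1.

  Under (1), one pass of \<open>T\<^sub>\<phi>\<close> over \<open>s\<close> followed by the normal form of \<open>g\<close> gives the normal form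
  of \<open>sg\<close>, so \<open>N'\<^sub>\<phi> w\<close> is the normal form of the element that \<open>w\<close> represents, filled up with
  letters 1, and (4) can be read off. Conversely, right-class 3 makes
  \<open>\<phi>\<^sub>2\<phi>\<^sub>1\<phi>\<^sub>2(r, s, t)\<close> normal, hence fixed by \<open>F\<^sub>1\<close>.
\<close>

section \<open>Local moves and passes on explicit words\<close>

lemma at_pos_1: "at_pos F (Suc 0) (a # b # w) = fst (F (a, b)) # snd (F (a, b)) # w"
  by (simp add: at_pos_def Let_def)

lemma at_pos_Suc: "1 \<le> i \<Longrightarrow> at_pos F (Suc i) (a # w) = a # at_pos F i w"
  by (cases i) (simp_all add: at_pos_def Let_def)

lemma at_pos_2: "at_pos F 2 (a # b # c # w) = a # fst (F (b, c)) # snd (F (b, c)) # w"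
  using at_pos_Suc[of 1 F a "b # c # w"] by (simp add: at_pos_1 numeral_2_eq_2)

lemma fold_at_pos_Suc:
  assumes "\<forall>i\<in>set is. 1 \<le> i"
  shows "fold (at_pos F) (map Suc is) (a # w) = a # fold (at_pos F) is w"
  using assms by (induction "is" arbitrary: w) (auto simp: at_pos_Suc)

text \<open>Only the first move of a pass touches the first letter; the second output of
  \<open>F\<close> is the letter carried on into the rest of the pass.\<close>

lemma T_phi_Cons_Cons:
  "T_phi F (a # b # w) = fst (F (a, b)) # T_phi F (snd (F (a, b)) # w)"
proof -
  have "[1..<length (a # b # w)] = Suc 0 # map Suc [1..<length (b # w)]"
    by (simp add: upt_conv_Cons map_Suc_upt del: upt_Suc)
  then show ?thesis
    by (simp add: T_phi_def at_pos_1 fold_at_pos_Suc del: upt_Suc)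
qed

lemma T_phi_singleton [simp]: "T_phi F [a] = [a]"
  by (simp add: T_phi_def)

lemma prod_list_removeAll_1 [simp]:
  "prod_list (removeAll 1 w) = prod_list (w :: 'a::monoid_mult list)"
  by (induction w) auto

section \<open>Word length and the factorisation map\<close>

locale factorable =
  fixes S :: "'a::monoid_mult set" and \<eta> :: "'a \<Rightarrow> 'a \<times> 'a"
  assumes factorable: "factorable_monoid S \<eta>"
begin

abbreviation hd_of :: "'a \<Rightarrow> 'a" where "hd_of f \<equiv> fst (\<eta> f)"
abbreviation tl_of :: "'a \<Rightarrow> 'a" where "tl_of f \<equiv> snd (\<eta> f)"
abbreviation F where "F \<equiv> eta_mu \<eta>"

lemma eta_mu_eq: "F (f, g) = \<eta> (f * g)"
  by (simp add: eta_mu_def)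

lemma one_in_S: "1 \<in> S" and generates_S: "generates S"
  using factorable by (auto simp: factorable_monoid_def)

lemma wlen_le: "w \<in> lists S \<Longrightarrow> wlen S (prod_list w) \<le> length w"
  unfolding wlen_def by (rule Least_le) auto

lemma shortest_word:
  obtains w where "w \<in> lists S" "prod_list w = f" "length w = wlen S f"
proof -
  obtain w where "w \<in> lists S" "prod_list w = f"
    using generates_S unfolding generates_def by blast
  then have "\<exists>n. \<exists>w\<in>lists S. prod_list w = f \<and> length w = n"
    by blast
  from LeastI_ex[OF this] show ?thesis
    using that unfolding wlen_def by blast
qed

lemma wlen_one [simp]: "wlen S 1 = 0"
  using wlen_le[of "[]"] by simp

lemma wlen_eq_0 [simp]: "wlen S f = 0 \<longleftrightarrow> f = 1"
proof
  assume "wlen S f = 0"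
  then show "f = 1"
    by (metis shortest_word length_0_conv prod_list.Nil)
qed simp

lemma wlen_le_1_iff: "wlen S f \<le> 1 \<longleftrightarrow> f \<in> S"
proof
  assume le: "wlen S f \<le> 1"
  obtain w where w: "w \<in> lists S" "prod_list w = f" "length w = wlen S f"
    by (rule shortest_word)
  show "f \<in> S"
  proof (cases w)
    case (Cons a v)
    then have "v = []"
      using le unfolding w(3)[symmetric] by simp
    with Cons w show ?thesis
      by simp
  qed (use w one_in_S in auto)
next
  assume "f \<in> S"
  then show "wlen S f \<le> 1"
    using wlen_le[of "[f]"] by simp
qed

lemma wlen_mult: "wlen S (f * g) \<le> wlen S f + wlen S g"
proof -
  obtain u where u: "u \<in> lists S" "prod_list u = f" "length u = wlen S f"
    by (rule shortest_word)
  obtain v where v: "v \<in> lists S" "prod_list v = g" "length v = wlen S g"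
    by (rule shortest_word)
  show ?thesis
    using wlen_le[of "u @ v"] u v by simp
qed

lemma factorisation: "factorisation_map S \<eta>"
  using factorable by (simp add: factorable_monoid_def factorability_structure_def)

lemma eta_one [simp]: "\<eta> 1 = (1, 1)"
  using factorisation by (simp add: factorisation_map_def)

lemma eta_props:
  shows eta_mult [simp]: "hd_of f * tl_of f = f"
    and wlen_eta: "wlen S f = wlen S (hd_of f) + wlen S (tl_of f)"
    and hd_of_in_S [simp]: "hd_of f \<in> S"
    and hd_of_eq_1_iff: "hd_of f = 1 \<longleftrightarrow> f = 1"
  using factorisation one_in_S
  by (cases "f = 1"; auto simp: factorisation_map_def)+

lemma eta_mu_eta [simp]: "F (\<eta> f) = \<eta> f"
  by (cases "\<eta> f") (metis eta_mu_eq eta_mult fst_conv snd_conv)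

text \<open>For \<open>f\<close> other than 1 the head is a nontrivial generator, of length exactly
  1; truncated subtraction covers \<open>f = 1\<close>.\<close>

lemma wlen_tl_of: "wlen S (tl_of f) = wlen S f - 1"
proof (cases "f = 1")
  case False
  then have "wlen S (hd_of f) = 1"
    using wlen_le_1_iff[of "hd_of f"] wlen_eq_0[of "hd_of f"] hd_of_in_S hd_of_eq_1_iff
    by (metis One_nat_def le_Suc_eq le_zero_eq)
  then show ?thesis
    using wlen_eta[of f] by simp
qed simp

lemma wlen_tl_of_less: "f \<noteq> 1 \<Longrightarrow> wlen S (tl_of f) < wlen S f"
  by (metis wlen_tl_of wlen_eq_0 diff_less zero_less_one neq0_conv)

lemma eta_gen: "s \<in> S \<Longrightarrow> \<eta> s = (s, 1)"
proof -
  assume "s \<in> S"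
  then have "tl_of s = 1"
    using wlen_tl_of[of s] wlen_le_1_iff[of s] by simp
  with eta_mult[of s] show ?thesis
    by (simp add: prod_eq_iff)
qed

text \<open>The product has length at most 2, so its tail has length at most 1. This is why
  \<open>phi\<close> stays inside pairs over \<open>S\<close>.\<close>

lemma tl_of_mult_in_S: "r \<in> S \<Longrightarrow> s \<in> S \<Longrightarrow> tl_of (r * s) \<in> S"
  using wlen_tl_of[of "r * s"] wlen_mult[of r s] wlen_le_1_iff[of r] wlen_le_1_iff[of s]
    wlen_le_1_iff[of "tl_of (r * s)"] by linarith

lemma phi_eq: "r \<in> S \<Longrightarrow> s \<in> S \<Longrightarrow> phi S \<eta> (r, s) = \<eta> (r * s)"
  by (simp add: phi_def eta_mu_def)

text \<open>In the case of dropping lengths only the inequality for the middle map is kept: it is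
  the one refuted in each application.\<close>

lemma factorability_cases:
  obtains (eq)
      "(at_pos F 1 \<circ> at_pos F 2 \<circ> at_pos F 1 \<circ> at_pos F 2) [f, g, h]
        = (at_pos F 2 \<circ> at_pos F 1 \<circ> at_pos F 2) [f, g, h]"
      "(at_pos F 2 \<circ> at_pos F 1 \<circ> at_pos F 2) [f, g, h]
        = (at_pos F 2 \<circ> at_pos F 1 \<circ> at_pos F 2 \<circ> at_pos F 1) [f, g, h]"
  | (less)
      "total_wlen S ((at_pos F 2 \<circ> at_pos F 1 \<circ> at_pos F 2) [f, g, h])
        < total_wlen S [f, g, h]"
  using factorable unfolding factorable_monoid_def factorability_structure_def Let_def by blast

section \<open>Pairs fixed by \<open>F\<close> and the recognition principle\<close>

definition stable :: "'a \<Rightarrow> 'a \<Rightarrow> bool" where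
  "stable f g \<longleftrightarrow> \<eta> (f * g) = (f, g)"

lemma stable_eta: "stable (hd_of f) (tl_of f)"
  by (simp add: stable_def)

text \<open>On \<open>[1, f, g]\<close> the moves 2, 1, 2 give \<open>[f, hd_of g, tl_of g]\<close>
  without loss of length. So the equality case of factorability applies, and one more move at
  position 1 must leave this word alone.\<close>

lemma stable_hd_ofI:
  assumes "stable f g"
  shows "stable f (hd_of g)"
proof -
  have f: "f \<in> S"
    using assms hd_of_in_S[of "f * g"] by (simp add: stable_def)
  have "\<eta> (f * g) = (f, g)"
    using assms by (simp add: stable_def)
  then have b: "(at_pos F 2 \<circ> at_pos F 1 \<circ> at_pos F 2) [1, f, g] = [f, hd_of g, tl_of g]"
    using f by (simp add: at_pos_1 at_pos_2 eta_mu_eq eta_gen)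
  then have a: "(at_pos F 1 \<circ> at_pos F 2 \<circ> at_pos F 1 \<circ> at_pos F 2) [1, f, g]
      = [hd_of (f * hd_of g), tl_of (f * hd_of g), tl_of g]"
    by (simp add: at_pos_1 eta_mu_eq)
  show ?thesis
  proof (cases rule: factorability_cases[of 1 f g])
    case eq
    then show ?thesis
      using a b by (simp add: stable_def prod_eq_iff)
  next
    case less
    then have "wlen S f + (wlen S (hd_of g) + wlen S (tl_of g)) < wlen S f + wlen S g"
      unfolding b by (simp add: total_wlen_def)
    then show ?thesis
      unfolding wlen_eta[of g, symmetric] by simp
  qed
qed

lemma stable_hd_of_iff: "stable f (hd_of g) \<longleftrightarrow> stable f g"
proof
  assume s: "stable f (hd_of g)"
  have b: "(at_pos F 2 \<circ> at_pos F 1 \<circ> at_pos F 2) [f, g, 1] = [f, hd_of g, tl_of g]"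
    using s by (simp add: at_pos_1 at_pos_2 eta_mu_eq stable_def)
  \<comment> \<open>The fixed pair with product \<open>f * g\<close>. Comparing the outcomes of the
    moves 2, 1, 2 and 1, 2, 1, 2 on \<open>[f, g, 1]\<close> will identify it with
    \<open>(f, g)\<close>.\<close>
  define p q where "p = hd_of (f * g)" and "q = tl_of (f * g)"
  have "stable p (hd_of q)"
    unfolding p_def q_def by (rule stable_hd_ofI[OF stable_eta])
  then have c: "(at_pos F 2 \<circ> at_pos F 1 \<circ> at_pos F 2 \<circ> at_pos F 1) [f, g, 1]
      = [p, hd_of q, tl_of q]"
    by (simp add: at_pos_1 at_pos_2 eta_mu_eq stable_def p_def q_def)
  show "stable f g"
  proof (cases rule: factorability_cases[of f g 1])
    case eq
    then have "f = p" "hd_of g = hd_of q" "tl_of g = tl_of q"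
      using b c by simp_all
    then have "(f, g) = (p, q)"
      using eta_mult by (metis (no_types))
    then show ?thesis
      unfolding stable_def p_def q_def prod.collapse by metis
  next
    case less
    then have "wlen S f + (wlen S (hd_of g) + wlen S (tl_of g)) < wlen S f + wlen S g"
      unfolding b by (simp add: total_wlen_def)
    then show ?thesis
      unfolding wlen_eta[of g, symmetric] by simp
  qed
qed (rule stable_hd_ofI)

section \<open>Property (1) at single pairs and its reduction to generators\<close>

text \<open>Both equalities of property (1), at the pair \<open>(f, g)\<close>.\<close>

definition strong_at :: "'a \<Rightarrow> 'a \<Rightarrow> bool" where
  "strong_at f g \<longleftrightarrow> \<eta> (f * g) = (hd_of (f * hd_of g), tl_of (f * hd_of g) * tl_of g)"

lemma strong_at_iff_stable:
  "strong_at f g \<longleftrightarrow> stable (hd_of (f * hd_of g)) (tl_of (f * hd_of g) * tl_of g)"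
proof -
  have "hd_of (f * hd_of g) * (tl_of (f * hd_of g) * tl_of g) = f * g"
    by (metis eta_mult mult.assoc)
  then show ?thesis
    by (auto simp: strong_at_def stable_def)
qed

lemma F2121_eq_F212_iff:
  "(at_pos F 1 \<circ> at_pos F 2 \<circ> at_pos F 1 \<circ> at_pos F 2) [f, g, h] =
   (at_pos F 2 \<circ> at_pos F 1 \<circ> at_pos F 2) [f, g, h] \<longleftrightarrow> strong_at f (g * h)"
  \<comment> \<open>The left side is one further move at position 1 applied to the right side.
    Equality thus means that the first two letters of the latter are stable, and recognition
    replaces the second of them by the element of which it is the head.\<close>
  unfolding strong_at_iff_stable stable_hd_of_iff[of _ "_ * _", symmetric]
  by (simp add: at_pos_1 at_pos_2 eta_mu_eq stable_def prod_eq_iff)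

lemma strong_at_1_left: "strong_at 1 g"
  by (simp add: strong_at_def eta_gen)

lemma strong_at_gen_right: "s \<in> S \<Longrightarrow> strong_at f s"
  by (simp add: strong_at_def eta_gen)

lemma strong_at_all:
  assumes "\<forall>s\<in>S - {1}. \<forall>f. strong_at s f"
  shows "strong_at f g"
proof (induction "wlen S f" arbitrary: f rule: less_induct)
  case less
  show ?case
  proof (cases "f = 1")
    case False
    define s h where "s = hd_of f" and "h = tl_of f"
    have f: "f = s * h"
      by (simp add: s_def h_def)
    have "wlen S h < wlen S f"
      using False by (simp add: h_def wlen_tl_of_less)
    then have h: "strong_at h g"
      by (rule less)
    have s: "strong_at s x" for x
      using assms False hd_of_eq_1_iff[of f] by (auto simp: s_def)
    \<comment> \<open>Strength of \<open>h\<close> at \<open>g\<close> gives \<open>h * g\<close>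
      and \<open>h * hd_of g\<close> the same head. Hence expanding \<open>s * (h * g)\<close> and
      \<open>s * (h * hd_of g)\<close> by strength of \<open>s\<close> gives equal heads, and tails
      that differ by the factor \<open>tl_of g\<close>.\<close>
    from h s[of "h * g"] s[of "h * hd_of g"] show ?thesis
      by (simp add: strong_at_def f mult.assoc)
  qed (simp add: strong_at_1_left)
qed

text \<open>By recognition, strength at \<open>f\<close> with head \<open>t\<close> and tail
  \<open>g\<close> depends on \<open>g\<close> only through the head of \<open>u * g\<close>, where
  \<open>u = tl_of (s * t)\<close>. By induction that head is the one of \<open>u * hd_of g\<close>,
  so \<open>g\<close> may be replaced by a generator. The generator varies in the induction, and may
  be 1, because the hypothesis is used for \<open>u\<close>.\<close>

lemma strong_at_if_strong_at_gens:
  assumes "\<forall>r\<in>S - {1}. \<forall>s\<in>S - {1}. \<forall>t\<in>S - {1}. strong_at r (s * t)"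
    and "s \<in> S"
  shows "strong_at s f"
  using \<open>s \<in> S\<close>
proof (induction "wlen S f" arbitrary: s f rule: less_induct)
  case less
  define t g u where "t = hd_of f" and "g = tl_of f" and "u = tl_of (s * t)"
  show ?case
  proof (cases "s = 1 \<or> g = 1")
    case True
    then show ?thesis
    proof
      assume "g = 1"
      then have "f \<in> S"
        using eta_mult[of f] hd_of_in_S[of f] by (simp add: g_def)
      then show ?thesis
        by (rule strong_at_gen_right)
    qed (simp add: strong_at_1_left)
  next
    case False
    then have "f \<noteq> 1"
      by (auto simp: g_def)
    have t: "t \<in> S - {1}" "hd_of g \<in> S - {1}"
      using \<open>f \<noteq> 1\<close> False by (auto simp: t_def hd_of_eq_1_iff)
    have "u \<in> S"
      using less.prems by (auto simp: u_def t_def intro: tl_of_mult_in_S)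
    moreover have "wlen S g < wlen S f"
      using \<open>f \<noteq> 1\<close> by (simp add: g_def wlen_tl_of_less)
    ultimately have u: "hd_of (u * g) = hd_of (u * hd_of g)"
      using less.hyps[of g u] by (simp add: strong_at_def)
    have "stable t (hd_of g)"
      unfolding t_def g_def by (rule stable_hd_ofI[OF stable_eta])
    moreover have "strong_at s (t * hd_of g)"
      using assms(1) t less.prems False by blast
    ultimately have "stable (hd_of (s * t)) (u * hd_of g)"
      by (simp add: strong_at_iff_stable stable_def u_def)
    then have "stable (hd_of (s * t)) (u * g)"
      using u stable_hd_of_iff by metis
    then show ?thesis
      by (simp add: strong_at_iff_stable t_def u_def g_def)
  qed
qed

text \<open>Three nontrivial generators have total length 3 before and after the moves, so the
  alternative of dropping lengths is impossible.\<close>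

lemma strong_at_gens_if_no_one:
  assumes "r \<in> S - {1}" "s \<in> S - {1}" "t \<in> S - {1}"
    and "1 \<notin> set ((at_pos (phi S \<eta>) 2 \<circ> at_pos (phi S \<eta>) 1 \<circ> at_pos (phi S \<eta>) 2) [r, s, t])"
  shows "strong_at r (s * t)"
proof -
  have gens: "wlen S x = 1" if "x \<in> S" "x \<noteq> 1" for x
    using that wlen_le_1_iff[of x] wlen_eq_0[of x] by linarith
  define x u where "x = hd_of (r * hd_of (s * t))" and "u = tl_of (r * hd_of (s * t))"
  define y z where "y = hd_of (u * tl_of (s * t))" and "z = tl_of (u * tl_of (s * t))"
  have S: "tl_of (s * t) \<in> S" "x \<in> S" "u \<in> S" "y \<in> S" "z \<in> S"
    using assms by (auto simp: x_def u_def y_def z_def intro!: tl_of_mult_in_S)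
  have b: "(at_pos F 2 \<circ> at_pos F 1 \<circ> at_pos F 2) [r, s, t] = [x, y, z]"
    by (simp add: at_pos_1 at_pos_2 eta_mu_eq x_def u_def y_def z_def)
  have "1 \<notin> set [x, y, z]"
    using assms(4) assms(1-3) S
    by (simp add: at_pos_1 at_pos_2 phi_eq x_def u_def y_def z_def)
  then have "total_wlen S [x, y, z] = 3" "total_wlen S [r, s, t] = 3"
    using gens S assms(1-3) by (simp_all add: total_wlen_def)
  with b have "\<not> total_wlen S ((at_pos F 2 \<circ> at_pos F 1 \<circ> at_pos F 2) [r, s, t])
      < total_wlen S [r, s, t]"
    by simp
  then show ?thesis
    unfolding F2121_eq_F212_iff[symmetric] by (metis factorability_cases)
qed

section \<open>Normal forms of elements\<close>

text \<open>Since \<open>\<eta> 1 = (1, 1)\<close>, the normal form of \<open>f\<close> is continued by letters \<open>1\<close> when \<open>n\<close> exceeds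
  the length of \<open>f\<close>.\<close>

primrec nf :: "nat \<Rightarrow> 'a \<Rightarrow> 'a list" where
  "nf 0 f = []"
| "nf (Suc n) f = hd_of f # nf n (tl_of f)"

lemma length_nf [simp]: "length (nf n f) = n"
  by (induction n arbitrary: f) auto

lemma nf_in_lists: "nf n f \<in> lists S"
  by (induction n arbitrary: f) auto

lemma nf_one: "nf n 1 = replicate n 1"
  by (induction n) auto

lemma prod_list_nf: "wlen S f \<le> n \<Longrightarrow> prod_list (nf n f) = f"
  by (induction n arbitrary: f) (auto simp: wlen_tl_of)

lemma nf_append_ones: "wlen S f \<le> n \<Longrightarrow> nf (n + k) f = nf n f @ replicate k 1"
  by (induction n arbitrary: f) (auto simp: wlen_tl_of nf_one)

lemma one_in_nf_iff: "1 \<in> set (nf n f) \<longleftrightarrow> wlen S f < n"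
proof (induction n arbitrary: f)
  case (Suc n)
  show ?case
    using Suc[of "tl_of f"] wlen_eq_0[of f] by (auto simp: wlen_tl_of eq_commute[of 1] hd_of_eq_1_iff)
qed simp

lemma stable_factor_nf:
  assumes "nf n f = u @ [a, b] @ v"
  shows "stable a b"
  using assms
proof (induction u arbitrary: n f)
  case Nil
  then obtain m where "n = Suc (Suc m)"
    by (metis append_Nil append_Cons length_Cons length_nf)
  with Nil show ?case
    using stable_hd_ofI[OF stable_eta[of f]] by simp
next
  case (Cons x u)
  then show ?case
    by (cases n) auto
qed

lemma nf_if_stable_factors:
  assumes "w \<in> lists S" "\<And>u a b v. w = u @ [a, b] @ v \<Longrightarrow> stable a b"
  shows "nf (length w) (prod_list w) = w"
  using assms
proof (induction w)
  case (Cons a w)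
  have w: "nf (length w) (prod_list w) = w"
    using Cons.prems by (intro Cons.IH) (auto, metis append_Cons)
  have a: "a \<in> S"
    using Cons.hyps by simp
  have "stable a (prod_list w)"
  proof (cases w)
    case Nil
    then show ?thesis
      using a by (simp add: stable_def eta_gen)
  next
    case (Cons b v)
    then have "stable a b"
      using Cons.prems[of "[]" a b v] by simp
    \<comment> \<open>By induction \<open>w\<close> is the normal form of its product, so its first
      letter is the head of that product; recognition then passes from \<open>b\<close> to the whole
      product.\<close>
    moreover have "b = hd_of (prod_list w)"
      using w \<open>w = b # v\<close> by simp
    ultimately show ?thesis
      by (simp add: stable_hd_of_iff)
  qed
  then show ?case
    using w by (simp add: stable_def)
qed simp

section \<open>Two-letter words and right-class 3\<close>

text \<open>Property (1) is not assumed, so that the passage from (4) back to (3) can use this.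
  Deleting letters 1 and refilling at the end changes nothing, since \<open>\<eta>\<close> puts a 1
  first only in \<open>(1, 1)\<close>.\<close>

lemma N'_phi_pair:
  assumes "a \<in> S" "b \<in> S"
  shows "N'_phi (phi S \<eta>) [a, b] = [hd_of (a * b), tl_of (a * b)]"
proof -
  let ?N = "N_phi (phi S \<eta>)"
  have one: "?N [] = []" "\<And>s. ?N [s] = (if s = 1 then [] else [s])"
    by simp_all
  have T: "T_phi (phi S \<eta>) [a, b] = [hd_of (a * b), tl_of (a * b)]"
    using assms by (simp add: T_phi_Cons_Cons phi_eq)
  have ab: "hd_of (a * b) = 1 \<longleftrightarrow> a * b = 1"
    by (rule hd_of_eq_1_iff)
  show ?thesis
  proof (cases "a = 1 \<or> b = 1")
    case True
    then show ?thesis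
      using assms by (auto simp: N'_phi_def eta_gen)
  next
    case False
    have "?N [a, b] = (if a * b = 1 then [] else if tl_of (a * b) = 1 then [hd_of (a * b)]
        else [hd_of (a * b), tl_of (a * b)])"
      using False ab T by auto
    then show ?thesis
      by (auto simp: N'_phi_def)
  qed
qed

lemma N_bar_eq:
  assumes "a \<in> S" "b \<in> S"
  shows "N_bar (N'_phi (phi S \<eta>)) (a, b) = \<eta> (a * b)"
  using N'_phi_pair[OF assms] by (simp add: N_bar_def)

lemma N'_phi_pair_eq_iff:
  assumes "a \<in> S" "b \<in> S"
  shows "N'_phi (phi S \<eta>) [a, b] = [a, b] \<longleftrightarrow> stable a b"
  using N'_phi_pair[OF assms] by (auto simp: stable_def prod_eq_iff)

lemma strong_at_if_right_class:
  assumes "right_class S (N'_phi (phi S \<eta>)) 3"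
    and gens: "r \<in> S" "s \<in> S" "t \<in> S"
  shows "strong_at r (s * t)"
proof -
  define N where "N = N'_phi (phi S \<eta>)"
  define k x u y where "k = s * t" and "x = hd_of (r * hd_of k)" and "u = tl_of (r * hd_of k)"
    and "y = u * tl_of k"
  have S: "tl_of k \<in> S" "u \<in> S" "x \<in> S"
    using gens by (auto simp: k_def u_def x_def intro!: tl_of_mult_in_S)
  have q: "quadratic S N" and n: "normalisation S N"
    using assms(1) by (simp_all add: right_class_def quadratic_def N_def)
  have w: "[r, s, t] \<in> lists S"
    using gens by simp
  have "N [r, s, t] = alternate (N_bar N) 2 1 3 [r, s, t]"
    using assms(1) w unfolding right_class_def N_def by simp
  also have "\<dots> = [x, hd_of y, tl_of y]"
    using gens S
    by (simp add: N_def numeral_3_eq_3 at_pos_1 at_pos_2 N_bar_eq k_def u_def x_def y_def)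
  finally have *: "N [r, s, t] = [x, hd_of y, tl_of y]" .
  \<comment> \<open>Idempotence is the normalisation law with empty outer words.\<close>
  have "N (N [r, s, t]) = N [r, s, t]" "N [r, s, t] \<in> lists S"
    using n w unfolding normalisation_def by (metis append_Nil append_Nil2 lists.Nil)+
  moreover have "N [r, s, t] = [] @ [x, hd_of y] @ [tl_of y]"
    by (simp add: *)
  ultimately have "N [x, hd_of y] = [x, hd_of y]"
    using q unfolding quadratic_def by metis
  then have "stable x (hd_of y)"
    using S by (simp add: N_def N'_phi_pair_eq_iff)
  then show ?thesis
    by (simp add: strong_at_iff_stable stable_hd_of_iff x_def u_def y_def k_def)
qed

end

section \<open>The maps \<open>N_phi\<close> and \<open>N'_phi\<close> under property (1)\<close>

locale strongly_factorable = factorable +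
  assumes strong: "strong_at f g"
begin

lemma eta_strong: "\<eta> (f * g) = (hd_of (f * hd_of g), tl_of (f * hd_of g) * tl_of g)"
  using strong[of f g] by (simp add: strong_at_def)

text \<open>The carried letter times \<open>tl_of g\<close> is \<open>tl_of (s * g)\<close> by (1),
  so the induction continues along the tail. The map \<open>\<psi>\<close> is left open to serve
  both for \<open>phi\<close> and for \<open>N_bar\<close>.\<close>

lemma T_phi_nf:
  assumes \<psi>: "\<And>r s. r \<in> S \<Longrightarrow> s \<in> S \<Longrightarrow> \<psi> (r, s) = \<eta> (r * s)"
    and "s \<in> S" "wlen S g \<le> n"
  shows "T_phi \<psi> (s # nf n g) = nf (Suc n) (s * g)"
  using assms(2,3)
proof (induction n arbitrary: s g)
  case 0
  then show ?case
    by (simp add: eta_gen)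
next
  case (Suc n)
  have "tl_of (s * hd_of g) \<in> S"
    using Suc.prems by (intro tl_of_mult_in_S) auto
  moreover have "wlen S (tl_of g) \<le> n"
    using Suc.prems by (simp add: wlen_tl_of)
  ultimately show ?case
    using Suc.IH Suc.prems eta_strong[of s g] by (simp add: T_phi_Cons_Cons \<psi>)
qed

lemma N_phi_eq:
  assumes "w \<in> lists S"
  shows "N_phi (phi S \<eta>) w = nf (wlen S (prod_list w)) (prod_list w)"
  using assms
proof (induction "phi S \<eta>" w rule: N_phi.induct)
  case (2 s w)
  show ?case
  proof (cases "1 \<in> set (s # w)")
    case True
    have "removeAll 1 (s # w) \<in> lists S"
      using 2(4) by auto
    from 2(1)[OF True this] show ?thesis
      using True by (simp only: N_phi.simps if_True prod_list_removeAll_1)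
  next
    case False
    define g where "g = prod_list w"
    have w: "N_phi (phi S \<eta>) w = nf (wlen S g) g"
      using 2(2)[OF False] 2(4) by (simp add: g_def)
    define v where "v = T_phi (phi S \<eta>) (s # N_phi (phi S \<eta>) w)"
    have v: "v = nf (Suc (wlen S g)) (s * g)"
      unfolding v_def w using 2(4) by (intro T_phi_nf) (auto simp: phi_eq)
    \<comment> \<open>The pass yields a word one letter longer than the normal form of
      \<open>g\<close>; by this bound it still represents \<open>s * g\<close>, and it contains a 1
      exactly when the bound is strict.\<close>
    have le: "wlen S (s * g) \<le> Suc (wlen S g)"
      using wlen_mult[of s g] wlen_le_1_iff[of s] 2(4) by simp
    have eq: "N_phi (phi S \<eta>) (s # w) = (if 1 \<in> set v then N_phi (phi S \<eta>) v else v)"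
      using False by (simp only: N_phi.simps if_False Let_def v_def)
    show ?thesis
    proof (cases "1 \<in> set v")
      case True
      have "N_phi (phi S \<eta>) v = nf (wlen S (prod_list v)) (prod_list v)"
        using 2(3)[OF False v_def True] v nf_in_lists by metis
      with True eq v le show ?thesis
        by (simp add: prod_list_nf g_def del: nf.simps)
    next
      case False
      then have "wlen S (s * g) = Suc (wlen S g)"
        using le v one_in_nf_iff[of "Suc (wlen S g)" "s * g"] by simp
      with False eq v show ?thesis
        by (simp add: g_def)
    qed
  qed
qed simp

lemma N'_phi_eq:
  assumes "w \<in> lists S"
  shows "N'_phi (phi S \<eta>) w = nf (length w) (prod_list w)"
  using nf_append_ones[OF order_refl, of "prod_list w" "length w - wlen S (prod_list w)"]
    wlen_le[OF assms] by (simp add: N'_phi_def N_phi_eq[OF assms])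

section \<open>The normalisation, its presentation and its class\<close>

abbreviation N where "N \<equiv> N'_phi (phi S \<eta>)"

lemma N_in_lists: "w \<in> lists S \<Longrightarrow> N w \<in> lists S"
  by (simp add: N'_phi_eq nf_in_lists)

lemma length_N: "w \<in> lists S \<Longrightarrow> length (N w) = length w"
  by (simp add: N'_phi_eq)

lemma prod_list_N: "w \<in> lists S \<Longrightarrow> prod_list (N w) = prod_list w"
  by (simp add: N'_phi_eq prod_list_nf wlen_le)

text \<open>On words over \<open>S\<close> the value of \<open>N\<close> depends only on length and
  product, and replacing a factor \<open>v\<close> by \<open>N v\<close> keeps both.\<close>

lemma normalisation_N: "normalisation S N"
  unfolding normalisation_def
proof (intro conjI ballI)
  fix u v w assume *: "u \<in> lists S" "v \<in> lists S" "w \<in> lists S"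
  then have "u @ v @ w \<in> lists S" "u @ N v @ w \<in> lists S"
    using N_in_lists[of v] by auto
  then show "N (u @ v @ w) = N (u @ N v @ w)"
    using * by (simp add: N'_phi_eq[of "_ @ _"] prod_list_N length_N)
qed (simp_all add: nf_in_lists N'_phi_eq eta_gen)

lemma neutral_N: "neutral S N 1"
  unfolding neutral_def
proof (intro conjI ballI)
  fix w assume w: "w \<in> lists S"
  have 1: "nf (Suc (length w)) (prod_list w) = nf (length w) (prod_list w) @ [1]"
    using nf_append_ones[OF wlen_le[OF w], of 1] by simp
  have "w @ [1] \<in> lists S" "[1] @ w \<in> lists S"
    using w one_in_S by auto
  then show "N (w @ [1]) = N w @ [1]" "N ([1] @ w) = N w @ [1]"
    using 1 w by (simp_all add: N'_phi_eq del: nf.simps)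
qed (rule one_in_S)

lemma presented_by_N: "presented_by S ({(w, N w) | w. w \<in> lists S} \<union> {([1], [])})"
proof -
  define R where "R = {(w, N w) | w. w \<in> lists S} \<union> {([1], [])}"
  have prod: "prod_list u = prod_list v" if "word_cong S R u v" for u v
    using that by induction (auto simp: R_def prod_list_N[OF in_listsI])
  have N: "word_cong S R w (N w)" if "w \<in> lists S" for w
    using word_cong.rel[of w "N w" R "[]" S "[]"] that by (auto simp: R_def)
  have ones: "word_cong S R (w @ replicate k 1) w" if "w \<in> lists S" for w k
  proof (induction k)
    case 0
    show ?case
      using that by (simp add: word_cong.refl)
  next
    case (Suc k)
    have "word_cong S R (w @ [1] @ replicate k 1) (w @ [] @ replicate k 1)"
      using that one_in_S by (intro word_cong.rel) (auto simp: R_def)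
    with Suc show ?case
      by (auto intro: word_cong.trans)
  qed
  \<comment> \<open>The relation with \<open>N w\<close> followed by erasure of the filling letters
    1 leads from any word to a representative determined by its product.\<close>
  have nf: "word_cong S R w (nf (wlen S (prod_list w)) (prod_list w))" if "w \<in> lists S" for w
  proof -
    have "N w = nf (wlen S (prod_list w)) (prod_list w)
        @ replicate (length w - length (nf (wlen S (prod_list w)) (prod_list w))) 1"
      by (simp add: N'_phi_def N_phi_eq[OF that])
    then show ?thesis
      using N[OF that] ones[OF nf_in_lists] word_cong.trans by metis
  qed
  have "word_cong S R u v" if "u \<in> lists S" "v \<in> lists S" "prod_list u = prod_list v" for u v
    using nf[OF that(1)] nf[OF that(2)] that(3) by (auto intro: word_cong.sym word_cong.trans)
  with prod show ?thesis
    using generates_S unfolding presented_by_def R_def by blast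
qed

text \<open>Normalise the word behind the first letter, with positions shifted by one, then make a
  single pass over the whole.\<close>

lemma N_eq_fold_N_bar:
  assumes "w \<in> lists S"
  shows "\<exists>is. set is \<subseteq> {1..<length w} \<and> N w = fold (at_pos (N_bar N)) is w"
  using assms
proof (induction w)
  case Nil
  then show ?case
    by (intro exI[of _ "[]"]) (simp add: N'_phi_eq)
next
  case (Cons s w)
  then obtain js where js: "set js \<subseteq> {1..<length w}" "N w = fold (at_pos (N_bar N)) js w"
    by auto
  have s: "s \<in> S" and w: "w \<in> lists S"
    using Cons by auto
  have "fold (at_pos (N_bar N)) (map Suc js) (s # w) = s # N w"
    using js by (subst fold_at_pos_Suc) auto
  moreover have "T_phi (N_bar N) (s # N w) = N (s # w)"
    using T_phi_nf[of "N_bar N" s "prod_list w" "length w"] N_bar_eq s w wlen_le[OF w]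
      N'_phi_eq[OF w] N'_phi_eq[OF Cons.prems] by simp
  ultimately have "N (s # w) = fold (at_pos (N_bar N)) (map Suc js @ [1..<length (s # w)]) (s # w)"
    using length_N[OF w] by (simp add: T_phi_def)
  moreover have "set (map Suc js @ [1..<length (s # w)]) \<subseteq> {1..<length (s # w)}"
    using js by auto
  ultimately show ?case
    by blast
qed

lemma quadratic_N: "quadratic S N"
  unfolding quadratic_def
proof (intro conjI ballI)
  fix w assume w: "w \<in> lists S"
  have pair: "N [a, b] = [a, b] \<longleftrightarrow> stable a b" if "w = u @ [a, b] @ v" for u a b v
    using w that by (intro N'_phi_pair_eq_iff) auto
  show "N w = w \<longleftrightarrow> (\<forall>u a b v. w = u @ [a, b] @ v \<longrightarrow> N [a, b] = [a, b])"
  proof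
    assume "N w = w"
    then have "nf (length w) (prod_list w) = w"
      using w by (simp add: N'_phi_eq)
    then show "\<forall>u a b v. w = u @ [a, b] @ v \<longrightarrow> N [a, b] = [a, b]"
      using pair stable_factor_nf by metis
  next
    assume "\<forall>u a b v. w = u @ [a, b] @ v \<longrightarrow> N [a, b] = [a, b]"
    then show "N w = w"
      using w pair nf_if_stable_factors[OF w] N'_phi_eq[OF w] by metis
  qed
qed (use normalisation_N N_eq_fold_N_bar in auto)

lemma N_triple:
  assumes "a \<in> S" "b \<in> S" "c \<in> S"
  shows "N [a, b, c] = alternate (N_bar N) 2 1 3 [a, b, c]"
proof -
  define k x u where "k = b * c" and "x = hd_of (a * hd_of k)" and "u = tl_of (a * hd_of k)"
  have S: "tl_of k \<in> S" "u \<in> S" "tl_of (u * tl_of k) \<in> S"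
    using assms by (auto simp: k_def u_def intro!: tl_of_mult_in_S)
  have "\<eta> (a * k) = (x, u * tl_of k)"
    using eta_strong[of a k] by (simp add: x_def u_def)
  \<comment> \<open>The third letter of the normal form is the head of an element already in
    \<open>S\<close>, hence that element.\<close>
  then have "N [a, b, c] = [x, hd_of (u * tl_of k), tl_of (u * tl_of k)]"
    using assms S by (simp add: N'_phi_eq eta_gen k_def numeral_3_eq_3)
  then show ?thesis
    using assms S
    by (simp add: numeral_3_eq_3 at_pos_1 at_pos_2 N_bar_eq k_def u_def x_def)
qed

lemma of_class_N: "of_class S N 4 3"
  unfolding of_class_def left_class_def right_class_def
proof (intro conjI ballI impI quadratic_N)
  fix w assume "w \<in> lists S" "length w = 3"
  then obtain a b c where w: "w = [a, b, c]" and S: "a \<in> S" "b \<in> S" "c \<in> S"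
    by (auto simp: length_Suc_conv numeral_3_eq_3)
  then show "N w = alternate (N_bar N) 2 1 3 w"
    by (simp add: N_triple)
  define x y where "x = hd_of (a * b)" and "y = tl_of (a * b)"
  have xy: "x \<in> S" "y \<in> S" "x * (y * c) = a * (b * c)"
    using S by (auto simp: x_def y_def intro: tl_of_mult_in_S) (metis eta_mult mult.assoc)
  \<comment> \<open>Left-class 4 follows from right-class 3: a preliminary move at position 1 keeps
    the product, and with it the normal form.\<close>
  have "N w = N [x, y, c]"
    using S xy by (simp add: w N'_phi_eq del: nf.simps)
  also have "\<dots> = alternate (N_bar N) 2 1 3 [x, y, c]"
    using S xy by (intro N_triple)
  also have "[x, y, c] = at_pos (N_bar N) 1 w"
    using S by (simp add: w at_pos_1 N_bar_eq x_def y_def)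
  finally show "N w = alternate (N_bar N) 1 2 4 w"
    by (simp add: eval_nat_numeral)
qed

end

section \<open>Equivalence of the four properties\<close>

theorem proposition4p2p11:
  fixes S :: "'a::monoid_mult set"
    and \<eta> :: "'a \<Rightarrow> 'a \<times> 'a"
    and F \<phi> :: "'a \<times> 'a \<Rightarrow> 'a \<times> 'a"
    and P1 P2 P3 P4 :: bool
  assumes "factorable_monoid S \<eta>"
  defines "F \<equiv> eta_mu \<eta>"
    and "\<phi> \<equiv> phi S \<eta>"
  defines "P1 \<equiv> (\<forall>s\<in>S - {1}. \<forall>f.
      fst (\<eta> (s * f)) = fst (\<eta> (s * fst (\<eta> f))) \<and>
      snd (\<eta> (s * f)) = snd (\<eta> (s * fst (\<eta> f))) * snd (\<eta> f))"
    and "P2 \<equiv> (\<forall>f g h.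
      (at_pos F 1 \<circ> at_pos F 2 \<circ> at_pos F 1 \<circ> at_pos F 2) [f, g, h] =
      (at_pos F 2 \<circ> at_pos F 1 \<circ> at_pos F 2) [f, g, h])"
    and "P3 \<equiv> (\<forall>r\<in>S - {1}. \<forall>s\<in>S - {1}. \<forall>t\<in>S - {1}.
      1 \<in> set ((at_pos \<phi> 2 \<circ> at_pos \<phi> 1 \<circ> at_pos \<phi> 2) [r, s, t]) \<longrightarrow>
      (at_pos F 1 \<circ> at_pos F 2 \<circ> at_pos F 1 \<circ> at_pos F 2) [r, s, t] =
      (at_pos F 2 \<circ> at_pos F 1 \<circ> at_pos F 2) [r, s, t])"
    and "P4 \<equiv> normalisation_mod_1 S (N'_phi \<phi>) \<and> quadratic S (N'_phi \<phi>) \<and>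
      of_class S (N'_phi \<phi>) 4 3"
  shows "(P1 \<longleftrightarrow> P2) \<and> (P2 \<longleftrightarrow> P3) \<and> (P3 \<longleftrightarrow> P4)"
proof -
  interpret factorable S \<eta>
    using assms(1) by unfold_locales
  have P1: "P1 \<longleftrightarrow> (\<forall>s\<in>S - {1}. \<forall>f. strong_at s f)"
    unfolding P1_def strong_at_def prod_eq_iff fst_conv snd_conv ..
  have P2: "P2 \<longleftrightarrow> (\<forall>f g h. strong_at f (g * h))"
    unfolding P2_def F_def F2121_eq_F212_iff ..
  \<comment> \<open>The restriction to triples creating a 1 disappears, as all other triples of
    nontrivial generators satisfy the equation anyway.\<close>
  have P3: "P3 \<longleftrightarrow> (\<forall>r\<in>S - {1}. \<forall>s\<in>S - {1}. \<forall>t\<in>S - {1}. strong_at r (s * t))"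
    unfolding P3_def F_def \<phi>_def F2121_eq_F212_iff using strong_at_gens_if_no_one by blast
  have "P2" if "P1"
    using strong_at_all that unfolding P1 P2 by blast
  moreover have "P3" if "P2"
    using that unfolding P2 P3 by blast
  moreover have "P1" if "P3"
    using strong_at_if_strong_at_gens that unfolding P1 P3 by blast
  moreover have "P4" if "P1"
  proof -
    interpret strongly_factorable S \<eta>
      using strong_at_all that unfolding P1 by unfold_locales blast
    show ?thesis
      unfolding P4_def \<phi>_def normalisation_mod_1_def
      using normalisation_N neutral_N presented_by_N quadratic_N of_class_N by blast
  qed
  moreover have "P3" if "P4"
    using strong_at_if_right_class that unfolding P3 P4_def \<phi>_def of_class_def by blast
  ultimately show ?thesis
    by blast
qed

end
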